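(* Let $G_0\xleftarrow{\varphi_1}G_1\xleftarrow{\varphi_2}G_2\xleftarrow{\varphi_3}\cdots$ be a bidirectional proximal KR-covering of rank $2$ such that every $G_n$ ($n\ge1$) has rank $2$. Let $(X,f)$ be its inverse limit. Then $(X,f)$ is topologically conjugate to $(\bar X_1,\sigma)$.
   Context: A finite directed graph $G=(V(G),E(G))$ has $E(G)\subseteq V(G)\times V(G)$, and every vertex is assumed to have an incoming and an outgoing edge. A graph homomorphism $\varphi:G_1\to G_2$ is edge-surjective if $\varphi(E(G_1))=E(G_2)$; it is $+$directional if $(u,v),(u,v')\in E(G_1)$ implies $\varphi(v)=\varphi(v')$; it is bidirectional if moreover $(u,v),(u',v)\in E(G_1)$ implies $\varphi(u)=\varphi(u')$. A cover is a $+$directional edge-surjective homomorphism. A covering is a sequence of covers $G_0\xleftarrow{\varphi_1}G_1\xleftarrow{\varphi_2}\cdots$ with $G_0$ the graph with one vertex and one loop; it is bidirectional if all $\varphi_n$ are. Its inverse limit is $(X,f)$ with $X=\{(v_0,v_1,\dots)\in\prod_nV(G_n): v_n=\varphi_{n+1}(v_{n+1})\}$ (product topology) and $f(x)=y$ iff $(u_n,v_n)\in E(G_n)$ for all $n$, where $x=(u_n)_n$, $y=(v_n)_n$; for a bidirectional covering $f$ is a homeomorphism. A circuit of length (period) $l\ge1$ is a closed walk $(v_0,\dots,v_l=v_0)$ with $v_0,\dots,v_{l-1}$ distinct. A generalized figure 8 is a graph $G$ with a center $v_0$ and distinct circuits $c_1,\dots,c_r$ starting at $v_0$, pairwise meeting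 only in $v_0$, whose edges exhaust $E(G)$; $r$ is its rank. A KR-covering is a covering in which each $G_n$ is a generalized figure 8 with center $v_{n,0}$ and $\varphi_{n+1}(v_{n+1,0})=v_{n,0}$ for all $n\ge0$; its rank is the $\liminf$ of the ranks of the $G_n$. It is proximal if for each $n\ge1$ the graph $G_n$ has a unique circuit of length $1$. When $G_n$ has rank $2$ its circuits are written $e_n$ (length $1$) and $c_n$. The system $(\bar X_1,\sigma)$: for $x\in X$ and $i\in\mathbb Z$ let $\bar x(1,i)\in\{e_1,c_1\}$ be the unique circuit of $G_1$ containing the edge $(u,u')$, where $u,u'$ are the $G_1$-coordinates of $f^i(x)$ and $f^{i+1}(x)$. Put $\bar x[1]=(\bar x(1,i))_{i\in\mathbb Z}$, $\bar X_1=\{\bar x[1]:x\in X\}\subseteq\{e_1,c_1\}^{\mathbb Z}$, and let $\sigma$ be the left shift. *)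

theory Defs
  imports
    "HOL-Analysis.Analysis"
    "HOL-Library.Extended_Nat"
    "HOL-Library.Liminf_Limsup"
    "Graph_Theory.Pair_Digraph"
begin

section \<open>Graphs and covers\<close>

definition essential_graph :: "'a pair_pre_digraph \<Rightarrow> bool" where
  "essential_graph G \<longleftrightarrow> pair_fin_digraph G \<and>
     (\<forall>v\<in>pverts G. (\<exists>u. (u, v) \<in> parcs G) \<and> (\<exists>w. (v, w) \<in> parcs G))"

definition graph_hom :: "'a pair_pre_digraph \<Rightarrow> 'b pair_pre_digraph \<Rightarrow> ('a \<Rightarrow> 'b) \<Rightarrow> bool" where
  "graph_hom G H \<phi> \<longleftrightarrow> \<phi> ` pverts G \<subseteq> pverts H \<and>
     (\<forall>u v. (u, v) \<in> parcs G \<longrightarrow> (\<phi> u, \<phi> v) \<in> parcs H)"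

definition edge_surjective :: "'a pair_pre_digraph \<Rightarrow> 'b pair_pre_digraph \<Rightarrow> ('a \<Rightarrow> 'b) \<Rightarrow> bool" where
  "edge_surjective G H \<phi> \<longleftrightarrow> map_prod \<phi> \<phi> ` parcs G = parcs H"

definition plus_directional :: "'a pair_pre_digraph \<Rightarrow> ('a \<Rightarrow> 'b) \<Rightarrow> bool" where
  "plus_directional G \<phi> \<longleftrightarrow>
     (\<forall>u v v'. (u, v) \<in> parcs G \<longrightarrow> (u, v') \<in> parcs G \<longrightarrow> \<phi> v = \<phi> v')"

definition bidirectional :: "'a pair_pre_digraph \<Rightarrow> ('a \<Rightarrow> 'b) \<Rightarrow> bool" where
  "bidirectional G \<phi> \<longleftrightarrow> plus_directional G \<phi> \<and>
     (\<forall>u u' v. (u, v) \<in> parcs G \<longrightarrow> (u', v) \<in> parcs G \<longrightarrow> \<phi> u = \<phi> u')"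

definition graph_cover :: "'a pair_pre_digraph \<Rightarrow> 'b pair_pre_digraph \<Rightarrow> ('a \<Rightarrow> 'b) \<Rightarrow> bool" where
  "graph_cover G H \<phi> \<longleftrightarrow> graph_hom G H \<phi> \<and> edge_surjective G H \<phi> \<and> plus_directional G \<phi>"

text \<open>The map \<open>\<phi> n\<close> goes from \<open>G n\<close> to \<open>G (n - 1)\<close>; the value \<open>\<phi> 0\<close> is never used.\<close>

definition covering :: "(nat \<Rightarrow> 'a pair_pre_digraph) \<Rightarrow> (nat \<Rightarrow> 'a \<Rightarrow> 'a) \<Rightarrow> bool" where
  "covering G \<phi> \<longleftrightarrow>
     (\<forall>n. essential_graph (G n)) \<and>
     (\<exists>a. pverts (G 0) = {a} \<and> parcs (G 0) = {(a, a)}) \<and>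
     (\<forall>n. graph_cover (G (Suc n)) (G n) (\<phi> (Suc n)))"

definition bidirectional_covering :: "(nat \<Rightarrow> 'a pair_pre_digraph) \<Rightarrow> (nat \<Rightarrow> 'a \<Rightarrow> 'a) \<Rightarrow> bool" where
  "bidirectional_covering G \<phi> \<longleftrightarrow>
     covering G \<phi> \<and> (\<forall>n. bidirectional (G (Suc n)) (\<phi> (Suc n)))"


section \<open>Inverse limits\<close>

definition limit_space :: "(nat \<Rightarrow> 'a pair_pre_digraph) \<Rightarrow> (nat \<Rightarrow> 'a \<Rightarrow> 'a) \<Rightarrow> (nat \<Rightarrow> 'a) set" where
  "limit_space G \<phi> = {x. (\<forall>n. x n \<in> pverts (G n)) \<and> (\<forall>n. x n = \<phi> (Suc n) (x (Suc n)))}"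

definition limit_topology :: "(nat \<Rightarrow> 'a pair_pre_digraph) \<Rightarrow> (nat \<Rightarrow> 'a \<Rightarrow> 'a) \<Rightarrow> (nat \<Rightarrow> 'a) topology" where
  "limit_topology G \<phi> =
     subtopology (product_topology (\<lambda>n. discrete_topology (pverts (G n))) UNIV) (limit_space G \<phi>)"

definition limit_map :: "(nat \<Rightarrow> 'a pair_pre_digraph) \<Rightarrow> (nat \<Rightarrow> 'a \<Rightarrow> 'a) \<Rightarrow> (nat \<Rightarrow> 'a) \<Rightarrow> (nat \<Rightarrow> 'a)" where
  "limit_map G \<phi> x = (THE y. y \<in> limit_space G \<phi> \<and> (\<forall>n. (x n, y n) \<in> parcs (G n)))"

lemma limit_edge_forward:
  assumes "bidirectional_covering G \<phi>" and x: "x \<in> limit_space G \<phi>"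
  shows "\<exists>!y. y \<in> limit_space G \<phi> \<and> (\<forall>n. (x n, y n) \<in> parcs (G n))"
proof -
  have ess: "essential_graph (G n)" and hom: "graph_hom (G (Suc n)) (G n) (\<phi> (Suc n))"
    and bi: "bidirectional (G (Suc n)) (\<phi> (Suc n))" for n
    using assms(1) by (auto simp: bidirectional_covering_def covering_def graph_cover_def)
  have xv: "x n \<in> pverts (G n)" and xc: "x n = \<phi> (Suc n) (x (Suc n))" for n
    using x unfolding limit_space_def by blast+
  have "\<exists>w. (x n, w) \<in> parcs (G n)" for n
    using ess[of n] xv[of n] by (auto simp: essential_graph_def)
  then obtain w where w: "(x n, w n) \<in> parcs (G n)" for n by metis
  define y where "y n = \<phi> (Suc n) (w (Suc n))" for n
  have ye: "(x n, y n) \<in> parcs (G n)" for n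
    using hom[of n] w[of "Suc n"] xc[of n] unfolding graph_hom_def y_def by metis
  have unique: "z = y"
    if "z \<in> limit_space G \<phi>" "\<forall>n. (x n, z n) \<in> parcs (G n)" for z
  proof
    fix n
    have "z n = \<phi> (Suc n) (z (Suc n))"
      using that(1) unfolding limit_space_def by blast
    also have "\<dots> = y n"
      using that(2) bi[of n] w[of "Suc n"]
      unfolding bidirectional_def plus_directional_def y_def by blast
    finally show "z n = y n" .
  qed
  have "y n \<in> pverts (G n)" for n
    using ye[of n] ess[of n] pair_wf_digraph.in_arcsD2
    by (auto simp: essential_graph_def pair_fin_digraph_def)
  moreover have "y n = \<phi> (Suc n) (y (Suc n))" for n
    using bi[of n] ye[of "Suc n"] w[of "Suc n"]
    unfolding bidirectional_def plus_directional_def y_def by blast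
  ultimately have "y \<in> limit_space G \<phi>" unfolding limit_space_def by blast
  with ye unique show ?thesis by blast
qed

lemma limit_edge_backward:
  assumes "bidirectional_covering G \<phi>" and x: "x \<in> limit_space G \<phi>"
  shows "\<exists>!y. y \<in> limit_space G \<phi> \<and> (\<forall>n. (y n, x n) \<in> parcs (G n))"
proof -
  have ess: "essential_graph (G n)" and hom: "graph_hom (G (Suc n)) (G n) (\<phi> (Suc n))"
    and bi: "bidirectional (G (Suc n)) (\<phi> (Suc n))" for n
    using assms(1) by (auto simp: bidirectional_covering_def covering_def graph_cover_def)
  have xv: "x n \<in> pverts (G n)" and xc: "x n = \<phi> (Suc n) (x (Suc n))" for n
    using x unfolding limit_space_def by blast+
  have "\<exists>w. (w, x n) \<in> parcs (G n)" for n
    using ess[of n] xv[of n] by (auto simp: essential_graph_def)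
  then obtain w where w: "(w n, x n) \<in> parcs (G n)" for n by metis
  define y where "y n = \<phi> (Suc n) (w (Suc n))" for n
  have ye: "(y n, x n) \<in> parcs (G n)" for n
    using hom[of n] w[of "Suc n"] xc[of n] unfolding graph_hom_def y_def by metis
  have unique: "z = y"
    if "z \<in> limit_space G \<phi>" "\<forall>n. (z n, x n) \<in> parcs (G n)" for z
  proof
    fix n
    have "z n = \<phi> (Suc n) (z (Suc n))"
      using that(1) unfolding limit_space_def by blast
    also have "\<dots> = y n"
      using that(2) bi[of n] w[of "Suc n"]
      unfolding bidirectional_def y_def by blast
    finally show "z n = y n" .
  qed
  have "y n \<in> pverts (G n)" for n
    using ye[of n] ess[of n] pair_wf_digraph.in_arcsD1
    by (auto simp: essential_graph_def pair_fin_digraph_def)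
  moreover have "y n = \<phi> (Suc n) (y (Suc n))" for n
    using bi[of n] ye[of "Suc n"] w[of "Suc n"]
    unfolding bidirectional_def y_def by blast
  ultimately have "y \<in> limit_space G \<phi>" unfolding limit_space_def by blast
  with ye unique show ?thesis by blast
qed

text \<open>For a bidirectional covering the description in \<open>limit_map_def\<close> is proper and the map is
  a bijection, so that its negative iterates make sense.\<close>

lemma limit_map_bij:
  assumes "bidirectional_covering G \<phi>"
  shows "bij_betw (limit_map G \<phi>) (limit_space G \<phi>) (limit_space G \<phi>)"
proof -
  let ?X = "limit_space G \<phi>" and ?f = "limit_map G \<phi>"
  have f: "?f x \<in> ?X \<and> (\<forall>n. (x n, ?f x n) \<in> parcs (G n))" if "x \<in> ?X" for x
    unfolding limit_map_def by (rule theI'[OF limit_edge_forward[OF assms that]])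
  have eq: "?f x = y" if "x \<in> ?X" "y \<in> ?X" "\<forall>n. (x n, y n) \<in> parcs (G n)" for x y
    using limit_edge_forward[OF assms that(1)] f[OF that(1)] that by blast
  have "inj_on ?f ?X"
    by (rule inj_onI) (metis f limit_edge_backward[OF assms])
  moreover have "?f ` ?X = ?X"
    
  proof (intro equalityI subsetI)
    fix y assume "y \<in> ?X"
    with limit_edge_backward[OF assms] obtain x
      where "x \<in> ?X" "\<forall>n. (x n, y n) \<in> parcs (G n)" by blast
    with eq \<open>y \<in> ?X\<close> show "y \<in> ?f ` ?X" by blast
  qed (use f in blast)
  ultimately show ?thesis by (simp add: bij_betw_def)
qed

definition int_iterate :: "'x set \<Rightarrow> ('x \<Rightarrow> 'x) \<Rightarrow> int \<Rightarrow> 'x \<Rightarrow> 'x" where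
  "int_iterate X f i = (if 0 \<le> i then f ^^ nat i else inv_into X f ^^ nat (- i))"


section \<open>Generalized figures 8 and KR-coverings\<close>

text \<open>A circuit is represented by its list of edges; \<^const>\<open>pre_digraph.cycle\<close> allows loops.\<close>

definition circuit_at :: "'a pair_pre_digraph \<Rightarrow> 'a \<Rightarrow> ('a \<times> 'a) list \<Rightarrow> bool" where
  "circuit_at G v p \<longleftrightarrow>
     pre_digraph.cycle (with_proj G) p \<and> pre_digraph.awalk (with_proj G) v p v"

text \<open>\<open>C\<close> is the set of the circuits \<open>c\<^sub>1, \<dots>, c\<^sub>r\<close>.\<close>

definition figure_8 :: "'a pair_pre_digraph \<Rightarrow> 'a \<Rightarrow> ('a \<times> 'a) list set \<Rightarrow> bool" where
  "figure_8 G v C \<longleftrightarrow> v \<in> pverts G \<and> finite C \<and> (\<forall>p\<in>C. circuit_at G v p) \<and>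
     (\<forall>p\<in>C. \<forall>q\<in>C. p \<noteq> q \<longrightarrow> set (pawalk_verts v p) \<inter> set (pawalk_verts v q) = {v}) \<and>
     (\<Union>p\<in>C. set p) = parcs G"

text \<open>The rank does not depend on the choice of \<open>v\<close> and \<open>C\<close>: if every vertex lies on an edge, it
  equals \<open>\<bar>E(G)\<bar> - \<bar>V(G)\<bar> + 1\<close>.\<close>

definition figure_8_rank :: "'a pair_pre_digraph \<Rightarrow> nat" where
  "figure_8_rank G = (THE r. \<exists>v C. figure_8 G v C \<and> card C = r)"

definition KR_covering ::
  "(nat \<Rightarrow> 'a pair_pre_digraph) \<Rightarrow> (nat \<Rightarrow> 'a \<Rightarrow> 'a) \<Rightarrow> (nat \<Rightarrow> 'a) \<Rightarrow> bool" where
  "KR_covering G \<phi> v \<longleftrightarrow> covering G \<phi> \<and> (\<forall>n. \<exists>C. figure_8 (G n) (v n) C) \<and>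
     (\<forall>n. \<phi> (Suc n) (v (Suc n)) = v n)"

definition KR_rank :: "(nat \<Rightarrow> 'a pair_pre_digraph) \<Rightarrow> enat" where
  "KR_rank G = liminf (\<lambda>n. enat (figure_8_rank (G n)))"

definition proximal_covering :: "(nat \<Rightarrow> 'a pair_pre_digraph) \<Rightarrow> bool" where
  "proximal_covering G \<longleftrightarrow>
     (\<forall>n\<ge>1. \<exists>!p. pre_digraph.cycle (with_proj (G n)) p \<and> length p = 1)"


section \<open>Symbolic systems and conjugacy\<close>

text \<open>The sequence \<open>x[n]\<close> of those circuits from \<open>C\<close>, the circuits of \<open>G n\<close>, that are traversed
  by the \<open>G n\<close>-coordinate of the orbit of \<open>x\<close>.\<close>

definition circuit_itinerary ::
  "(nat \<Rightarrow> 'a pair_pre_digraph) \<Rightarrow> (nat \<Rightarrow> 'a \<Rightarrow> 'a) \<Rightarrow> nat \<Rightarrow> ('a \<times> 'a) list set \<Rightarrow>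
   (nat \<Rightarrow> 'a) \<Rightarrow> int \<Rightarrow> ('a \<times> 'a) list" where
  "circuit_itinerary G \<phi> n C x i =
     (let F = int_iterate (limit_space G \<phi>) (limit_map G \<phi>)
      in THE p. p \<in> C \<and> (F i x n, F (i + 1) x n) \<in> set p)"

definition circuit_shift_space ::
  "(nat \<Rightarrow> 'a pair_pre_digraph) \<Rightarrow> (nat \<Rightarrow> 'a \<Rightarrow> 'a) \<Rightarrow> nat \<Rightarrow> ('a \<times> 'a) list set \<Rightarrow>
   (int \<Rightarrow> ('a \<times> 'a) list) set" where
  "circuit_shift_space G \<phi> n C = circuit_itinerary G \<phi> n C ` limit_space G \<phi>"

definition circuit_shift_topology ::
  "(nat \<Rightarrow> 'a pair_pre_digraph) \<Rightarrow> (nat \<Rightarrow> 'a \<Rightarrow> 'a) \<Rightarrow> nat \<Rightarrow> ('a \<times> 'a) list set \<Rightarrow>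
   (int \<Rightarrow> ('a \<times> 'a) list) topology" where
  "circuit_shift_topology G \<phi> n C =
     subtopology (product_topology (\<lambda>i. discrete_topology C) UNIV) (circuit_shift_space G \<phi> n C)"

definition left_shift :: "(int \<Rightarrow> 'b) \<Rightarrow> int \<Rightarrow> 'b" where
  "left_shift s = (\<lambda>i. s (i + 1))"

definition topologically_conjugate ::
  "'x topology \<Rightarrow> ('x \<Rightarrow> 'x) \<Rightarrow> 'y topology \<Rightarrow> ('y \<Rightarrow> 'y) \<Rightarrow> bool" where
  "topologically_conjugate X f Y g \<longleftrightarrow>
     (\<exists>h. homeomorphic_map X Y h \<and> (\<forall>x\<in>topspace X. h (f x) = g (h x)))"

end

theory Submission
  imports Defs
begin

text \<open>The conjugacy is the map that sends \<open>x\<close> to its itinerary on the first level. It turns \<open>f\<close> into the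
  shift, and it is continuous, because each of its symbols is a function of one \<open>G\<^sub>2\<close>-coordinate of
  an iterate of \<open>x\<close>. The space \<open>X\<close> is compact and the shift space is Hausdorff, so it remains to
  prove that the itinerary determines \<open>x\<close>.

  For \<open>n \<ge> 1\<close> the graph \<open>G\<^sub>n\<close> consists of a loop and a longer circuit through the center \<open>v\<^sub>n\<close>, so a
  walk has a choice only at \<open>v\<^sub>n\<close>. Two walks in \<open>G\<^sub>n\<close> therefore agree from some time on if they are at
  the center simultaneously once and if, whenever they are there simultaneously, they make the same
  choice. Orbits are two-sided, so they agree everywhere if there are simultaneous visits
  arbitrarily far in the past (\<open>orbits_coincide\<close>).

  There are such visits for any two points \<open>x\<close> and \<open>y\<close> (\<open>common_center\<close>). The orbit of \<open>x\<close> visits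
  \<open>v\<^sub>m\<close> arbitrarily far in the past for every \<open>m\<close>. A directional map sends both edges that
  leave a center to the loop one level below, so a visit to \<open>v\<^sub>m\<close> shows on level \<open>n < m\<close> as a stay of
  \<open>m - n\<close> steps at \<open>v\<^sub>n\<close>. Choose \<open>m = n + l\<close>, where \<open>l\<close> is the length of the circuit of \<open>G\<^sub>n\<close>. During the
  stay of \<open>x\<close>, the orbit of \<open>y\<close> must visit \<open>v\<^sub>n\<close> as well.

  The choices agree on level 1 if the itineraries are equal. On level \<open>n + 1\<close> they agree if
  the two orbits have the same coordinates on level \<open>n\<close>: a walk that enters the circuit reaches, after
  a fixed time, the first vertex that is not mapped to \<open>v\<^sub>n\<close>, and a walk that is delayed at
  the loop cannot be at such a vertex at that time (\<open>delayed_walk_distinguishable\<close>). By induction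
  the two points have the same coordinates on all levels.\<close>

section \<open>Walks on a loop and a circuit\<close>

definition walk :: "('a \<times> 'a) set \<Rightarrow> (nat \<Rightarrow> 'a) \<Rightarrow> bool" where
  "walk A u \<longleftrightarrow> (\<forall>k. (u k, u (Suc k)) \<in> A)"

text \<open>The circuit is given by its vertices \<open>w 0, \<dots>, w l\<close> in cyclic order, so that both \<open>w 0\<close> and \<open>w l\<close>
  are the center.\<close>

definition loop_and_circuit :: "('a \<times> 'a) set \<Rightarrow> 'a \<Rightarrow> nat \<Rightarrow> (nat \<Rightarrow> 'a) \<Rightarrow> bool" where
  "loop_and_circuit A v l w \<longleftrightarrow>
     w 0 = v \<and> w l = v \<and> 2 \<le> l \<and> inj_on w {..<l} \<and>
     A = insert (v, v) ((\<lambda>k. (w k, w (Suc k))) ` {..<l})"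

lemma loop_and_circuit_off_center:
  assumes "loop_and_circuit A v l w" "0 < k" "k < l"
  shows "w k \<noteq> v"
proof -
  have "inj_on w {..<l}" "w 0 = v"
    using assms(1) by (auto simp: loop_and_circuit_def)
  then show ?thesis
    using assms(2,3) inj_onD[of w "{..<l}" k 0] by auto
qed

lemma loop_and_circuit_tail:
  assumes "loop_and_circuit A v l w" "(a, b) \<in> A"
  shows "\<exists>k<l. a = w k"
proof -
  have "0 < l" "w 0 = v" "A = insert (v, v) ((\<lambda>k. (w k, w (Suc k))) ` {..<l})"
    using assms(1) by (auto simp: loop_and_circuit_def)
  then show ?thesis using assms(2) by auto
qed

lemma loop_and_circuit_step:
  assumes "loop_and_circuit A v l w" "(w k, b) \<in> A" "k < l"
  shows "b = w (Suc k) \<or> k = 0 \<and> b = v"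
proof -
  have A: "inj_on w {..<l}" "A = insert (v, v) ((\<lambda>k. (w k, w (Suc k))) ` {..<l})"
    using assms(1) by (auto simp: loop_and_circuit_def)
  consider "w k = v" "b = v" | k' where "k' < l" "w k = w k'" "b = w (Suc k')"
    using assms(2) A(2) by auto
  then show ?thesis
  proof cases
    case 1
    then show ?thesis using loop_and_circuit_off_center[OF assms(1), of k] assms(3) by blast
  next
    case 2
    then show ?thesis using A(1) assms(3) by (auto dest!: inj_onD)
  qed
qed

lemma loop_and_circuit_unique_step:
  assumes "loop_and_circuit A v l w" "(a, b) \<in> A" "(a, b') \<in> A" "a \<noteq> v"
  shows "b = b'"
proof -
  obtain k where k: "k < l" "a = w k" using loop_and_circuit_tail[OF assms(1,2)] by blast
  moreover have "w 0 = v" using assms(1) by (simp add: loop_and_circuit_def)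
  ultimately have "k \<noteq> 0" using assms(4) by metis
  then show ?thesis
    using loop_and_circuit_step[OF assms(1), of k] assms(2,3) k by metis
qed

lemma walk_follows_circuit:
  assumes "loop_and_circuit A v l w" "walk A u" "u i = w k" "0 < k" "k + t \<le> l"
  shows "u (i + t) = w (k + t)"
  using assms(5)
proof (induction t)
  case 0
  show ?case using assms(3) by simp
next
  case (Suc t)
  then have "u (i + t) = w (k + t)" by simp
  moreover have "(u (i + t), u (Suc (i + t))) \<in> A"
    using assms(2) by (simp add: walk_def)
  ultimately show ?case
    using loop_and_circuit_step[OF assms(1), of "k + t"] Suc.prems assms(4) by auto
qed

text \<open>A walk that is not at the center is inside the circuit and has no choice before it comes back to
  the center.\<close>

lemma walk_hits_center:
  assumes "loop_and_circuit A v l w" "walk A u"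
  shows "\<exists>t\<le>l. u t = v"
proof (cases "u 0 = v")
  case False
  obtain k where k: "k < l" "u 0 = w k"
    using loop_and_circuit_tail[OF assms(1)] assms(2) unfolding walk_def by blast
  have "0 < k" using k False assms(1) by (cases k) (auto simp: loop_and_circuit_def)
  then have "u (l - k) = w l"
    using walk_follows_circuit[OF assms k(2), of "l - k"] k(1) by simp
  moreover have "w l = v" using assms(1) by (simp add: loop_and_circuit_def)
  ultimately show ?thesis by (metis diff_le_self)
qed auto

text \<open>At time 1 the walk \<open>u\<close> is at the center, while \<open>u'\<close> has already entered the circuit. Let \<open>w a\<close> be the first vertex of the circuit with \<open>\<phi> (w a) \<noteq> \<phi> v\<close>. At time \<open>a\<close> the walk
  \<open>u'\<close> is there, while \<open>u\<close> is still at one of \<open>w 0, \<dots>, w (a - 1)\<close>, so that the two images differ.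
  Walks with the same image exist only if there is no such \<open>a\<close>.\<close>

lemma delayed_walk_distinguishable:
  assumes G: "loop_and_circuit A v l w" and walks: "walk A u" "walk A u'"
    and start: "u 1 = v" "u' 1 = w 1"
    and image: "\<And>k. \<phi> (u k) = \<phi> (u' k)"
  shows "\<forall>k<l. \<phi> (w k) = \<phi> v"
proof (rule ccontr)
  assume "\<not> (\<forall>k<l. \<phi> (w k) = \<phi> v)"
  then have "\<exists>a. (a < l \<and> \<phi> (w a) \<noteq> \<phi> v) \<and> (\<forall>k<a. \<not> (k < l \<and> \<phi> (w k) \<noteq> \<phi> v))"
    by (intro exists_least_iff[THEN iffD1]) auto
  then obtain a where a: "a < l" "\<phi> (w a) \<noteq> \<phi> v"
    and below: "\<forall>k<a. \<not> (k < l \<and> \<phi> (w k) \<noteq> \<phi> v)"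
    by blast
  have small: "\<phi> (w k) = \<phi> v" if "k < a" for k
    using that a(1) below by auto
  have w0: "w 0 = v" using G by (simp add: loop_and_circuit_def)
  have "0 < a" using a(2) w0 by (cases a) auto
  have "u' a = w a"
    using walk_follows_circuit[OF G walks(2), of 1 1 "a - 1"] start(2) a(1) \<open>0 < a\<close> by simp
  \<comment> \<open>A step advances along the circuit by at most one vertex and \<open>u\<close> is at \<open>w 0\<close> at time 1, so \<open>u\<close> stays behind.\<close>
  moreover have lag: "\<exists>i\<le>t. u (Suc t) = w i" if "t < a" for t
    using that
  proof (induction t)
    case 0
    then show ?case using start(1) w0 by auto
  next
    case (Suc t)
    then obtain i where i: "i \<le> t" "u (Suc t) = w i" by auto
    have "(w i, u (Suc (Suc t))) \<in> A"
      using walks(1) i(2) unfolding walk_def by metis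
    then have "u (Suc (Suc t)) = w (Suc i) \<or> u (Suc (Suc t)) = w 0"
      using loop_and_circuit_step[OF G, of i] i(1) Suc.prems a(1) w0 by auto
    then show ?case using i(1) by (metis Suc_le_mono le0)
  qed
  obtain i where "i \<le> a - 1" "u a = w i"
    using lag[of "a - 1"] \<open>0 < a\<close> by auto
  then have "i < a" "u a = w i" using \<open>0 < a\<close> by linarith+
  ultimately show False using image[of a] small a(2) by metis
qed

lemma lifted_walks_step_together:
  assumes G: "loop_and_circuit A v l w" and walks: "walk A u" "walk A u'"
    and start: "u 0 = v" "u' 0 = v"
    and image: "\<And>k. \<phi> (u k) = \<phi> (u' k)"
    and nonconst: "k < l" "\<phi> (w k) \<noteq> \<phi> v"
  shows "u 1 = u' 1"
proof -
  have "w 0 = v" "0 < l" using G by (auto simp: loop_and_circuit_def)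
  then have "z 1 = w 1 \<or> z 1 = v" if "walk A z" "z 0 = v" for z
    using loop_and_circuit_step[OF G, of 0 "z 1"] that unfolding walk_def
    by (metis One_nat_def)
  then show ?thesis
    using delayed_walk_distinguishable[OF G walks, where \<phi> = \<phi>]
      delayed_walk_distinguishable[OF G walks(2,1), where \<phi> = \<phi>]
      walks start image nonconst by metis
qed


section \<open>A generalized figure 8 of rank two with a loop\<close>

lemma pcas_nth:
  assumes "pcas u p u'"
  shows "pawalk_verts u p ! 0 = u" "pawalk_verts u p ! length p = u'"
    "k < length p \<Longrightarrow> p ! k = (pawalk_verts u p ! k, pawalk_verts u p ! Suc k)"
proof -
  have first: "pawalk_verts z q ! 0 = z" if "pcas z q z'" for z q z'
    using that by (cases q) auto
  show "pawalk_verts u p ! 0 = u" using first[OF assms] .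
  show "pawalk_verts u p ! length p = u'" using assms
    by (induction p arbitrary: u) auto
  show "p ! k = (pawalk_verts u p ! k, pawalk_verts u p ! Suc k)" if "k < length p"
    using assms that
  proof (induction p arbitrary: u k)
    case (Cons a p)
    then show ?case
      using first[of "snd a" p u'] by (cases k) (auto simp: prod_eq_iff)
  qed simp
qed

lemma length_pawalk_verts: "length (pawalk_verts u p) = Suc (length p)"
  by (induction p arbitrary: u) auto

lemma circuit_at_parametrization:
  assumes "circuit_at G v p"
  obtains w where "w 0 = v" "w (length p) = v" "0 < length p" "inj_on w {..<length p}"
    "set p = (\<lambda>k. (w k, w (Suc k))) ` {..<length p}"
proof -
  obtain u where u: "pcas u p u" "distinct (tl (pawalk_verts u p))" "p \<noteq> []"
    using assms by (auto simp: circuit_at_def pre_digraph.cycle_def pre_digraph.awalk_def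
        cas_with_proj_eq awalk_verts_with_proj_eq)
  have p: "pcas v p v"
    using assms by (auto simp: circuit_at_def pre_digraph.awalk_def cas_with_proj_eq)
  have "u = v" using u p by (cases p) auto
  define w where "w k = pawalk_verts v p ! k" for k
  have ends: "w 0 = v" "w (length p) = v" using pcas_nth[OF p] by (auto simp: w_def)
  \<comment> \<open>The definition of a cycle lets only the first vertex, which is also the last, occur twice.\<close>
  have inj: "i = j" if "0 < i" "0 < j" "i \<le> length p" "j \<le> length p" "w i = w j" for i j
  proof -
    have "tl (pawalk_verts v p) ! (i - 1) = tl (pawalk_verts v p) ! (j - 1)"
      using that by (simp add: nth_tl length_pawalk_verts w_def)
    then have "i - 1 = j - 1"
      using u(2) \<open>u = v\<close> that by (subst (asm) nth_eq_iff_index_eq) (auto simp: length_pawalk_verts)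
    then show ?thesis using that by simp
  qed
  have "inj_on w {..<length p}"
  proof (rule inj_onI)
    fix i j assume *: "i \<in> {..<length p}" "j \<in> {..<length p}" "w i = w j"
    have "k = 0" if "w k = w 0" "k < length p" for k
      using inj[of k "length p"] that ends u(3) by (cases k) auto
    then show "i = j" using * inj[of i j] by (cases "i = 0"; cases "j = 0") auto
  qed
  moreover have "set p = (\<lambda>k. (w k, w (Suc k))) ` {..<length p}"
    using pcas_nth(3)[OF p] by (force simp: set_conv_nth w_def image_iff)
  ultimately show ?thesis using that ends u(3) by auto
qed

text \<open>The second circuit has length at least 2, because \<open>[(v, v)]\<close> is the only circuit of length 1 that
  starts at \<open>v\<close>.\<close>

lemma figure_8_loop_and_circuit:
  assumes "figure_8 G v {e, c}" "e \<noteq> c" "length e = 1"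
  obtains w where "loop_and_circuit (parcs G) v (length c) w" "set e = {(v, v)}"
    "set c = (\<lambda>k. (w k, w (Suc k))) ` {..<length c}"
proof -
  have e: "circuit_at G v e" and c: "circuit_at G v c" and arcs: "set e \<union> set c = parcs G"
    using assms(1) by (auto simp: figure_8_def)
  have single: "p = [(v, v)]" if "circuit_at G v p" "length p = 1" for p
  proof -
    obtain a where "p = [a]" using \<open>length p = 1\<close> by (auto simp: length_Suc_conv)
    then show ?thesis
      using that(1) by (auto simp: circuit_at_def pre_digraph.awalk_def cas_with_proj_eq prod_eq_iff)
  qed
  obtain w where w: "w 0 = v" "w (length c) = v" "0 < length c" "inj_on w {..<length c}"
    "set c = (\<lambda>k. (w k, w (Suc k))) ` {..<length c}"
    using circuit_at_parametrization[OF c] by blast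
  have "length c \<noteq> 1" using single[OF e assms(3)] single[OF c] assms(2) by metis
  with w(3) have "2 \<le> length c" by linarith
  then show ?thesis
    using that[of w] w arcs single[OF e assms(3)] by (auto simp: loop_and_circuit_def)
qed

lemma loop_not_in_circuit:
  assumes "loop_and_circuit A v l w"
  shows "(v, v) \<notin> (\<lambda>k. (w k, w (Suc k))) ` {..<l}"
proof
  assume "(v, v) \<in> (\<lambda>k. (w k, w (Suc k))) ` {..<l}"
  then obtain k where k: "k < l" "w k = v" "w (Suc k) = v" by auto
  then have "k = 0" using loop_and_circuit_off_center[OF assms] by blast
  moreover have "2 \<le> l" using assms by (simp add: loop_and_circuit_def)
  ultimately show False using loop_and_circuit_off_center[OF assms, of 1] k by auto
qed


section \<open>Two-sided orbits in the inverse limit\<close>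

lemma
  assumes "bij_betw f X X" "x \<in> X"
  shows int_iterate_in: "int_iterate X f i x \<in> X"
    and int_iterate_step: "int_iterate X f (i + 1) x = f (int_iterate X f i x)"
    and int_iterate_shift: "int_iterate X f i (f x) = int_iterate X f (i + 1) x"
proof -
  let ?g = "inv_into X f"
  have fg: "f y \<in> X" "?g y \<in> X" "f (?g y) = y" "?g (f y) = y" if "y \<in> X" for y
    using assms(1) that
    by (auto simp: bij_betw_def inv_into_into f_inv_into_f)
  have fn: "(f ^^ n) y \<in> X" and gn: "(?g ^^ n) y \<in> X" if "y \<in> X" for n y
    using that fg by (induction n) auto
  show "int_iterate X f i x \<in> X"
    using fn gn assms(2) by (simp add: int_iterate_def)
  show "int_iterate X f (i + 1) x = f (int_iterate X f i x)"
  proof (cases "0 \<le> i")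
    case True
    then show ?thesis by (simp add: int_iterate_def nat_add_distrib)
  next
    case False
    then have "nat (- i) = Suc (nat (- (i + 1)))" by simp
    then show ?thesis using False fg(3)[OF gn[OF assms(2)]]
      by (auto simp: int_iterate_def)
  qed
  show "int_iterate X f i (f x) = int_iterate X f (i + 1) x"
  proof (cases "0 \<le> i")
    case True
    then show ?thesis by (simp add: int_iterate_def nat_add_distrib funpow_swap1)
  next
    case False
    then have "nat (- i) = Suc (nat (- (i + 1)))" by simp
    then show ?thesis using False fg(4)[OF assms(2)]
      by (auto simp: int_iterate_def funpow_swap1)
  qed
qed

lemma topspace_limit_topology: "topspace (limit_topology G \<phi>) = limit_space G \<phi>"
  by (auto simp: limit_topology_def limit_space_def)

lemma limit_map_step:
  assumes "bidirectional_covering G \<phi>" "x \<in> limit_space G \<phi>"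
  shows "limit_map G \<phi> x \<in> limit_space G \<phi>" "(x n, limit_map G \<phi> x n) \<in> parcs (G n)"
  using theI'[OF limit_edge_forward[OF assms]] unfolding limit_map_def by blast+

lemma continuous_map_limit_coordinate:
  assumes "g ` pverts (G n) \<subseteq> S"
  shows "continuous_map (limit_topology G \<phi>) (discrete_topology S) (\<lambda>x. g (x n))"
proof -
  have "continuous_map (product_topology (\<lambda>n. discrete_topology (pverts (G n))) UNIV)
      (discrete_topology (pverts (G n))) (\<lambda>x. x n)"
    by (rule continuous_map_product_projection) simp
  then have "continuous_map (limit_topology G \<phi>) (discrete_topology (pverts (G n))) (\<lambda>x. x n)"
    unfolding limit_topology_def by (rule continuous_map_from_subtopology)
  moreover have "continuous_map (discrete_topology (pverts (G n))) (discrete_topology S) g"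
    using assms by (simp add: Pi_iff image_subset_iff)
  ultimately have "continuous_map (limit_topology G \<phi>) (discrete_topology S) (g \<circ> (\<lambda>x. x n))"
    by (rule continuous_map_compose)
  then show ?thesis by (simp only: o_def)
qed

text \<open>The function \<open>g\<close> is arbitrary outside the coordinates of points of the limit, so its other values
  are first replaced by an element of \<open>S\<close>.\<close>

lemma continuous_map_to_discrete_factor:
  assumes "\<And>x. x \<in> limit_space G \<phi> \<Longrightarrow> h x = g (x n)"
    and "\<And>x. x \<in> limit_space G \<phi> \<Longrightarrow> h x \<in> S"
  shows "continuous_map (limit_topology G \<phi>) (discrete_topology S) h"
proof (cases "limit_space G \<phi> = {}")
  case True
  then have "limit_topology G \<phi> = trivial_topology"
    using topspace_limit_topology[of G \<phi>] by (simp add: null_topspace_iff_trivial)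
  then show ?thesis by simp
next
  case False
  then obtain s where s: "s \<in> S" using assms(2) by blast
  have "continuous_map (limit_topology G \<phi>) (discrete_topology S)
      (\<lambda>x. (\<lambda>a. if g a \<in> S then g a else s) (x n))"
    using s by (intro continuous_map_limit_coordinate) auto
  then show ?thesis
    by (rule continuous_map_eq) (use assms in \<open>auto simp: topspace_limit_topology\<close>)
qed

lemma continuous_map_limit_selfmap:
  assumes "k ` limit_space G \<phi> \<subseteq> limit_space G \<phi>"
    and "\<And>n. \<exists>g. \<forall>x\<in>limit_space G \<phi>. k x n = g (x (Suc n))"
  shows "continuous_map (limit_topology G \<phi>) (limit_topology G \<phi>) k"
proof -
  have "continuous_map (limit_topology G \<phi>) (discrete_topology (pverts (G n))) (\<lambda>x. k x n)" for n
  proof -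
    obtain g where "\<forall>x\<in>limit_space G \<phi>. k x n = g (x (Suc n))" using assms(2) by blast
    moreover have "k x n \<in> pverts (G n)" if "x \<in> limit_space G \<phi>" for x
      using assms(1) that by (auto simp: limit_space_def)
    ultimately show ?thesis by (intro continuous_map_to_discrete_factor) auto
  qed
  then have "continuous_map (limit_topology G \<phi>)
      (product_topology (\<lambda>n. discrete_topology (pverts (G n))) UNIV) k"
    by (simp add: continuous_map_componentwise_UNIV)
  then show ?thesis
    using assms(1) topspace_limit_topology[of G \<phi>]
    unfolding limit_topology_def[of G \<phi>] by (auto simp: continuous_map_in_subtopology)
qed

text \<open>Any edge that leaves \<open>x (n + 1)\<close> will do, since \<open>\<phi> (n + 1)\<close> identifies the heads of all of them. The
  level is lowered by one because \<open>G (n + 1)\<close> itself may offer several successors.\<close>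

lemma limit_next_coordinate:
  assumes "bidirectional_covering G \<phi>"
  obtains g where "\<And>x. x \<in> limit_space G \<phi> \<Longrightarrow> limit_map G \<phi> x n = g (x (Suc n))"
proof -
  have bi: "bidirectional (G (Suc n)) (\<phi> (Suc n))"
    using assms by (simp add: bidirectional_covering_def)
  have "limit_map G \<phi> x n = \<phi> (Suc n) (SOME b. (x (Suc n), b) \<in> parcs (G (Suc n)))"
    if "x \<in> limit_space G \<phi>" for x
  proof -
    note st = limit_map_step[OF assms that]
    have "limit_map G \<phi> x n = \<phi> (Suc n) (limit_map G \<phi> x (Suc n))"
      using st(1) unfolding limit_space_def by blast
    then show ?thesis
      using st(2)[of "Suc n"] bi someI[of "\<lambda>b. (x (Suc n), b) \<in> parcs (G (Suc n))"]
      unfolding bidirectional_def plus_directional_def by metis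
  qed
  then show ?thesis by (rule that)
qed

lemma limit_previous_coordinate:
  assumes "bidirectional_covering G \<phi>"
  obtains g where "\<And>x. x \<in> limit_space G \<phi> \<Longrightarrow>
    inv_into (limit_space G \<phi>) (limit_map G \<phi>) x n = g (x (Suc n))"
proof -
  let ?X = "limit_space G \<phi>" and ?f = "limit_map G \<phi>"
  have bi: "bidirectional (G (Suc n)) (\<phi> (Suc n))"
    using assms by (simp add: bidirectional_covering_def)
  have "inv_into ?X ?f x n = \<phi> (Suc n) (SOME b. (b, x (Suc n)) \<in> parcs (G (Suc n)))"
    if "x \<in> ?X" for x
  proof -
    let ?y = "inv_into ?X ?f x"
    have y: "?y \<in> ?X" "?f ?y = x"
      using limit_map_bij[OF assms] that
      by (auto simp: bij_betw_def inv_into_into f_inv_into_f)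
    have "?y n = \<phi> (Suc n) (?y (Suc n))"
      using y(1) unfolding limit_space_def by blast
    then show ?thesis
      using limit_map_step(2)[OF assms y(1), of "Suc n"] y(2) bi
        someI[of "\<lambda>b. (b, x (Suc n)) \<in> parcs (G (Suc n))"]
      unfolding bidirectional_def by metis
  qed
  then show ?thesis by (rule that)
qed

lemma continuous_map_funpow:
  assumes "continuous_map X X f"
  shows "continuous_map X X (f ^^ n)"
  using assms by (induction n) (auto simp: id_def intro: continuous_map_compose)

lemma continuous_map_int_iterate_limit_map:
  assumes "bidirectional_covering G \<phi>"
  shows "continuous_map (limit_topology G \<phi>) (limit_topology G \<phi>)
    (int_iterate (limit_space G \<phi>) (limit_map G \<phi>) i)"
proof -
  have bij: "bij_betw (limit_map G \<phi>) (limit_space G \<phi>) (limit_space G \<phi>)"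
    by (rule limit_map_bij[OF assms])
  have "continuous_map (limit_topology G \<phi>) (limit_topology G \<phi>) (limit_map G \<phi>)"
  proof (rule continuous_map_limit_selfmap)
    show "\<exists>g. \<forall>x\<in>limit_space G \<phi>. limit_map G \<phi> x n = g (x (Suc n))" for n
      using limit_next_coordinate[OF assms] by metis
  qed (use bij in \<open>auto simp: bij_betw_def\<close>)
  moreover have "continuous_map (limit_topology G \<phi>) (limit_topology G \<phi>)
      (inv_into (limit_space G \<phi>) (limit_map G \<phi>))"
  proof (rule continuous_map_limit_selfmap)
    show "\<exists>g. \<forall>x\<in>limit_space G \<phi>.
        inv_into (limit_space G \<phi>) (limit_map G \<phi>) x n = g (x (Suc n))" for n
      using limit_previous_coordinate[OF assms] by metis
  qed (use bij_betw_inv_into[OF bij] in \<open>auto simp: bij_betw_def\<close>)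
  ultimately show ?thesis
    by (simp add: int_iterate_def continuous_map_funpow)
qed

text \<open>The limit is a closed subset of a product of finite discrete spaces.\<close>

lemma compact_space_limit_topology:
  assumes "covering G \<phi>"
  shows "compact_space (limit_topology G \<phi>)"
proof -
  let ?P = "product_topology (\<lambda>n. discrete_topology (pverts (G n))) UNIV"
  have fin: "finite (pverts (G n))" for n
    using assms unfolding covering_def essential_graph_def
    by (meson pair_fin_digraph.pair_finite_verts)
  have hom: "\<phi> (Suc n) ` pverts (G (Suc n)) \<subseteq> pverts (G n)" for n
    using assms by (simp add: covering_def graph_cover_def graph_hom_def)
  have proj: "continuous_map ?P (discrete_topology (pverts (G n))) (\<lambda>x. x n)" for n
    by (rule continuous_map_product_projection) simp
  have "closedin ?P {x \<in> topspace ?P. x n = \<phi> (Suc n) (x (Suc n))}" for n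
  proof (rule closedin_continuous_maps_eq)
    have "continuous_map (discrete_topology (pverts (G (Suc n))))
        (discrete_topology (pverts (G n))) (\<phi> (Suc n))"
      using hom by auto
    from continuous_map_compose[OF proj this]
    show "continuous_map ?P (discrete_topology (pverts (G n))) (\<lambda>x. \<phi> (Suc n) (x (Suc n)))"
      by (simp add: o_def)
  qed (auto intro: proj)
  then have "closedin ?P (\<Inter>n. {x \<in> topspace ?P. x n = \<phi> (Suc n) (x (Suc n))})"
    by blast
  moreover have "(\<Inter>n. {x \<in> topspace ?P. x n = \<phi> (Suc n) (x (Suc n))}) = limit_space G \<phi>"
    by (auto simp: limit_space_def)
  moreover have "compact_space ?P"
    using fin by (simp add: compact_space_product_topology compact_space_discrete_topology)
  ultimately show ?thesis
    unfolding limit_topology_def by (metis closedin_compact_space compact_space_subtopology)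
qed


section \<open>Two orbits with the same first coordinates\<close>

text \<open>Level 0 is left out because \<open>G 0\<close> has only the loop.\<close>

locale loop_circuit_covering =
  fixes G :: "nat \<Rightarrow> 'a pair_pre_digraph"
    and \<phi> :: "nat \<Rightarrow> 'a \<Rightarrow> 'a"
    and v :: "nat \<Rightarrow> 'a"
    and l :: "nat \<Rightarrow> nat"
    and w :: "nat \<Rightarrow> nat \<Rightarrow> 'a"
  assumes bidirectional: "bidirectional_covering G \<phi>"
    and centers: "\<phi> (Suc n) (v (Suc n)) = v n"
    and levels: "n \<ge> 1 \<Longrightarrow> loop_and_circuit (parcs (G n)) (v n) (l n) (w n)"
begin

abbreviation X where "X \<equiv> limit_space G \<phi>"
abbreviation f where "f \<equiv> limit_map G \<phi>"
abbreviation orbit where "orbit \<equiv> int_iterate X f"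

lemma orbit_in: "x \<in> X \<Longrightarrow> orbit i x \<in> X"
  using int_iterate_in[OF limit_map_bij[OF bidirectional]] .

lemma orbit_step: "x \<in> X \<Longrightarrow> orbit (i + 1) x = f (orbit i x)"
  using int_iterate_step[OF limit_map_bij[OF bidirectional]] .

lemma orbit_edge: "x \<in> X \<Longrightarrow> (orbit i x n, orbit (i + 1) x n) \<in> parcs (G n)"
  using limit_map_step(2)[OF bidirectional orbit_in] by (simp add: orbit_step)

lemma orbit_project: "x \<in> X \<Longrightarrow> \<phi> (Suc n) (orbit i x (Suc n)) = orbit i x n"
  using orbit_in[of x i] unfolding limit_space_def by (metis (mono_tags, lifting) mem_Collect_eq)

lemma orbit_walk:
  assumes "x \<in> X"
  shows "walk (parcs (G n)) (\<lambda>k. orbit (i + int k) x n)"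
  using orbit_edge[OF assms, of "i + int k" n for k] by (simp add: walk_def add_ac)

text \<open>The maps are directional and send centers to centers, and every center has a loop, so the successor
  of a center is mapped to a center. Each level that is descended hence prolongs the stay at the
  center by one step.\<close>

lemma center_run:
  assumes "x \<in> X" "orbit i x (n + L) = v (n + L)" "k \<le> L"
  shows "orbit (i + int k) x n = v n"
  using assms(2,3)
proof (induction L arbitrary: i k)
  case 0
  then show ?case by simp
next
  case (Suc L)
  let ?m = "n + L"
  have here: "orbit i x ?m = v ?m"
    using Suc.prems(1) orbit_project[OF assms(1), of ?m i] centers[of ?m] by simp
  have "(v (Suc ?m), v (Suc ?m)) \<in> parcs (G (Suc ?m))"
    using levels[of "Suc ?m"] by (auto simp: loop_and_circuit_def)
  moreover have "(v (Suc ?m), orbit (i + 1) x (Suc ?m)) \<in> parcs (G (Suc ?m))"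
    using orbit_edge[OF assms(1), of i "Suc ?m"] Suc.prems(1) by simp
  moreover have "plus_directional (G (Suc ?m)) (\<phi> (Suc ?m))"
    using bidirectional by (simp add: bidirectional_covering_def bidirectional_def)
  ultimately have "\<phi> (Suc ?m) (orbit (i + 1) x (Suc ?m)) = v ?m"
    using centers[of ?m] unfolding plus_directional_def by metis
  then have nxt: "orbit (i + 1) x ?m = v ?m"
    using orbit_project[OF assms(1)] by simp
  show ?case
  proof (cases "k \<le> L")
    case True
    then show ?thesis using Suc.IH[OF here] by blast
  next
    case False
    then have "k = Suc L" using Suc.prems(2) by simp
    then show ?thesis using Suc.IH[OF nxt, of L] by (simp add: add_ac)
  qed
qed

lemma orbit_hits_center:
  assumes "x \<in> X" "n \<ge> 1"
  shows "\<exists>t\<le>l n. orbit (i + int t) x n = v n"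
  using walk_hits_center[OF levels[OF assms(2)] orbit_walk[OF assms(1)]] .

text \<open>The circuit of level \<open>n\<close> has length \<open>l n\<close>. A visit of \<open>x\<close> to the center of level \<open>n + l n\<close> keeps \<open>x\<close>
  at the center of level \<open>n\<close> for \<open>l n\<close> steps, which is long enough for \<open>y\<close> to come by.\<close>

lemma common_center:
  assumes "x \<in> X" "y \<in> X" "n \<ge> 1"
  shows "\<exists>j\<le>i. orbit j x n = v n \<and> orbit j y n = v n"
proof -
  let ?m = "n + l n"
  \<comment> \<open>The first visit after this time and the wait for \<open>y\<close> that follows it end by time \<open>i\<close>.\<close>
  let ?i = "i - int (l n) - int (l ?m)"
  obtain s where s: "s \<le> l ?m" "orbit (?i + int s) x ?m = v ?m"
    using orbit_hits_center[OF assms(1), of ?m ?i] assms(3) by auto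
  obtain t where t: "t \<le> l n" "orbit (?i + int s + int t) y n = v n"
    using orbit_hits_center[OF assms(2,3)] by blast
  have "orbit (?i + int s + int t) x n = v n"
    using center_run[OF assms(1) s(2) t(1)] .
  then show ?thesis using s(1) t
    by (intro exI[of _ "?i + int s + int t"]) auto
qed

text \<open>Away from the center a walk has only one continuation. Agreement at one time thus spreads to all
  later times, and \<open>common_center\<close> supplies such a time before any given \<open>i\<close>.\<close>

lemma orbits_coincide:
  assumes "x \<in> X" "y \<in> X" "n \<ge> 1"
    and together: "\<And>j. orbit j x n = v n \<Longrightarrow> orbit j y n = v n \<Longrightarrow>
      orbit (j + 1) x n = orbit (j + 1) y n"
  shows "orbit i x n = orbit i y n"
proof -
  obtain j where j: "j \<le> i" "orbit j x n = v n" "orbit j y n = v n"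
    using common_center[OF assms(1-3)] by blast
  from j(1) show ?thesis
  proof (induction i rule: int_ge_induct)
    case base
    then show ?case using j by simp
  next
    case (step i)
    then show ?case
      using together[of i] orbit_edge[OF assms(1), of i n] orbit_edge[OF assms(2), of i n]
        loop_and_circuit_unique_step[OF levels[OF assms(3)]] by metis
  qed
qed

text \<open>By edge-surjectivity, some edge is mapped to an edge whose tail is off the center.\<close>

lemma bonding_map_nonconstant_on_circuit:
  assumes "n \<ge> 1"
  shows "\<exists>k<l (Suc n). \<phi> (Suc n) (w (Suc n) k) \<noteq> \<phi> (Suc n) (v (Suc n))"
proof -
  have level: "2 \<le> l n" "parcs (G n) = insert (v n, v n) ((\<lambda>k. (w n k, w n (Suc k))) ` {..<l n})"
    using levels[OF assms] by (auto simp: loop_and_circuit_def)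
  then have "(w n 1, w n 2) \<in> parcs (G n)" by (auto simp: numeral_2_eq_2)
  moreover have "edge_surjective (G (Suc n)) (G n) (\<phi> (Suc n))"
    using bidirectional by (simp add: bidirectional_covering_def covering_def graph_cover_def)
  ultimately have "(w n 1, w n 2) \<in> map_prod (\<phi> (Suc n)) (\<phi> (Suc n)) ` parcs (G (Suc n))"
    by (simp add: edge_surjective_def)
  then obtain a b where "(a, b) \<in> parcs (G (Suc n))" "\<phi> (Suc n) a = w n 1"
    by fastforce
  then show ?thesis
    using loop_and_circuit_tail[OF levels[of "Suc n"]] centers[of n] level(1)
      loop_and_circuit_off_center[OF levels[OF assms], of 1] by fastforce
qed

lemma orbits_lift:
  assumes "x \<in> X" "y \<in> X" "n \<ge> 1" and coincide: "\<And>i. orbit i x n = orbit i y n"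
  shows "orbit i x (Suc n) = orbit i y (Suc n)"
proof (rule orbits_coincide[OF assms(1,2)])
  fix j assume start: "orbit j x (Suc n) = v (Suc n)" "orbit j y (Suc n) = v (Suc n)"
  obtain k where k: "k < l (Suc n)" "\<phi> (Suc n) (w (Suc n) k) \<noteq> \<phi> (Suc n) (v (Suc n))"
    using bonding_map_nonconstant_on_circuit[OF assms(3)] by blast
  have "orbit (j + int 1) x (Suc n) = orbit (j + int 1) y (Suc n)"
    by (rule lifted_walks_step_together[OF levels orbit_walk[OF assms(1)] orbit_walk[OF assms(2)] _ _ _ k])
      (use start coincide orbit_project assms(1,2) in auto)
  then show "orbit (j + 1) x (Suc n) = orbit (j + 1) y (Suc n)" by simp
qed simp

lemma first_level_determines:
  assumes "x \<in> X" "y \<in> X" and first: "\<And>i. orbit i x 1 = orbit i y 1"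
  shows "x = y"
proof -
  have all: "orbit i x (Suc n) = orbit i y (Suc n)" for i n
    by (induction n arbitrary: i) (use first orbits_lift[OF assms(1,2)] in auto)
  have "orbit 0 x n = orbit 0 y n" for n
    using all[of 0 n] orbit_project[OF assms(1), of n 0] orbit_project[OF assms(2), of n 0] by metis
  then show ?thesis by (auto simp: int_iterate_def)
qed

section \<open>The itinerary map\<close>

context
  fixes e c :: "('a \<times> 'a) list"
  assumes loop: "set e = {(v 1, v 1)}"
    and circuit: "set c = (\<lambda>k. (w 1 k, w 1 (Suc k))) ` {..<l 1}"
begin

lemma edge_in_unique_circuit:
  assumes "a \<in> parcs (G 1)"
  shows "\<exists>!p. p \<in> {e, c} \<and> a \<in> set p"
proof -
  have "parcs (G 1) = set e \<union> set c"
    using levels[of 1] loop circuit by (auto simp: loop_and_circuit_def)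
  moreover have "set e \<inter> set c = {}"
    using loop_not_in_circuit[OF levels[of 1]] loop circuit by simp
  ultimately show ?thesis using assms by blast
qed

abbreviation itinerary where "itinerary \<equiv> circuit_itinerary G \<phi> 1 {e, c}"

lemma itinerary_edge:
  assumes "x \<in> X"
  shows "itinerary x i \<in> {e, c}" "(orbit i x 1, orbit (i + 1) x 1) \<in> set (itinerary x i)"
  using theI'[OF edge_in_unique_circuit[OF orbit_edge[OF assms, of i 1]]]
  by (simp_all add: circuit_itinerary_def Let_def)

text \<open>At a simultaneous visit to the center, the common symbol tells whether both orbits take the loop or
  both enter the circuit.\<close>

lemma itinerary_determines:
  assumes "x \<in> X" "y \<in> X" and same: "itinerary x = itinerary y"
  shows "x = y"
proof (rule first_level_determines[OF assms(1,2)])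
  fix i
  show "orbit i x 1 = orbit i y 1"
  proof (rule orbits_coincide[OF assms(1,2)])
    fix j assume start: "orbit j x 1 = v 1" "orbit j y 1 = v 1"
    have out: "b = b'" if "(v 1, b) \<in> set p" "(v 1, b') \<in> set p" "p \<in> {e, c}" for b b' p
    proof (cases "set p = set e")
      case True
      then show ?thesis using that loop by auto
    next
      case False
      then have "p = c" using that(3) by auto
      have "b = w 1 1" if edge: "(v 1, b) \<in> set c" for b
      proof -
        obtain k where "k < l 1" "v 1 = w 1 k" "b = w 1 (Suc k)" using edge circuit by auto
        then show ?thesis
          using loop_and_circuit_off_center[OF levels[of 1], of k] by (cases k) auto
      qed
      then show ?thesis using that \<open>p = c\<close> by blast
    qed
    show "orbit (j + 1) x 1 = orbit (j + 1) y 1"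
      using out[of _ "itinerary x j"] itinerary_edge[OF assms(1), of j]
        itinerary_edge[OF assms(2), of j] start same by metis
  qed simp
qed

lemma itinerary_shift:
  assumes "x \<in> X"
  shows "itinerary (f x) = left_shift (itinerary x)"
  using int_iterate_shift[OF limit_map_bij[OF bidirectional] assms]
  by (simp add: fun_eq_iff circuit_itinerary_def Let_def left_shift_def)

text \<open>The \<open>G\<^sub>1\<close>-coordinates of both \<open>x\<close> and \<open>f x\<close> are functions of the \<open>G\<^sub>2\<close>-coordinate of \<open>x\<close>, so the
  symbol at time 0 depends on that coordinate alone. The other symbols follow by continuity of the
  iterates of \<open>f\<close>.\<close>

lemma continuous_map_itinerary:
  "continuous_map (limit_topology G \<phi>) (discrete_topology {e, c}) (\<lambda>x. itinerary x i)"
proof -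
  obtain g where g: "\<And>x. x \<in> X \<Longrightarrow> f x 1 = g (x (Suc 1))"
    using limit_next_coordinate[OF bidirectional] by blast
  define h where "h x = (THE p. p \<in> {e, c} \<and> (x 1, f x 1) \<in> set p)" for x
  have it: "itinerary x i = h (orbit i x)" if "x \<in> X" for x
    by (simp add: h_def circuit_itinerary_def Let_def orbit_step[OF that])
  have "continuous_map (limit_topology G \<phi>) (discrete_topology {e, c}) h"
  proof (rule continuous_map_to_discrete_factor)
    fix x assume x: "x \<in> X"
    have "x 1 = \<phi> (Suc 1) (x (Suc 1))" using x unfolding limit_space_def by blast
    then show "h x = (\<lambda>a. THE p. p \<in> {e, c} \<and> (\<phi> (Suc 1) a, g a) \<in> set p) (x (Suc 1))"
      using g[OF x] by (simp add: h_def)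
    show "h x \<in> {e, c}"
      using theI'[OF edge_in_unique_circuit[OF limit_map_step(2)[OF bidirectional x]]]
      unfolding h_def by blast
  qed
  from continuous_map_compose[OF continuous_map_int_iterate_limit_map[OF bidirectional, of i] this]
  show ?thesis
    by (rule continuous_map_eq) (simp add: it topspace_limit_topology del: One_nat_def)
qed

lemma homeomorphic_map_itinerary:
  "homeomorphic_map (limit_topology G \<phi>) (circuit_shift_topology G \<phi> 1 {e, c}) itinerary"
proof (rule continuous_imp_homeomorphic_map)
  let ?P = "product_topology (\<lambda>i::int. discrete_topology {e, c}) UNIV"
  have cont: "continuous_map (limit_topology G \<phi>) ?P itinerary"
    using continuous_map_itinerary by (simp add: continuous_map_componentwise_UNIV)
  then show "continuous_map (limit_topology G \<phi>) (circuit_shift_topology G \<phi> 1 {e, c}) itinerary"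
    by (auto simp: circuit_shift_topology_def continuous_map_in_subtopology
        circuit_shift_space_def topspace_limit_topology)
  show "compact_space (limit_topology G \<phi>)"
    by (rule compact_space_limit_topology) (use bidirectional in \<open>simp add: bidirectional_covering_def\<close>)
  show "Hausdorff_space (circuit_shift_topology G \<phi> 1 {e, c})"
    unfolding circuit_shift_topology_def
    by (intro Hausdorff_space_subtopology) (simp add: Hausdorff_space_product_topology)
  show "itinerary ` topspace (limit_topology G \<phi>) = topspace (circuit_shift_topology G \<phi> 1 {e, c})"
    using continuous_map_image_subset_topspace[OF cont]
    by (auto simp: circuit_shift_topology_def circuit_shift_space_def topspace_limit_topology)
  show "inj_on itinerary (topspace (limit_topology G \<phi>))"
    by (auto simp: topspace_limit_topology intro!: inj_onI itinerary_determines)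
qed

lemma topologically_conjugate_itinerary:
  "topologically_conjugate (limit_topology G \<phi>) f (circuit_shift_topology G \<phi> 1 {e, c}) left_shift"
  unfolding topologically_conjugate_def topspace_limit_topology
  using homeomorphic_map_itinerary itinerary_shift by blast

end

end


section \<open>The conjugacy\<close>

theorem proposition6p7:
  fixes G :: "nat \<Rightarrow> 'a pair_pre_digraph"
    and \<phi> :: "nat \<Rightarrow> 'a \<Rightarrow> 'a"
    and v :: "nat \<Rightarrow> 'a"
    and e c :: "nat \<Rightarrow> ('a \<times> 'a) list"
  assumes "KR_covering G \<phi> v"
    and "bidirectional_covering G \<phi>"
    and "proximal_covering G"
    and "KR_rank G = 2"
    and "\<And>n. n \<ge> 1 \<Longrightarrow> figure_8_rank (G n) = 2"
    and "\<And>n. n \<ge> 1 \<Longrightarrow> figure_8 (G n) (v n) {e n, c n} \<and> e n \<noteq> c n \<and> length (e n) = 1"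
  shows "topologically_conjugate
           (limit_topology G \<phi>) (limit_map G \<phi>)
           (circuit_shift_topology G \<phi> 1 {e 1, c 1}) left_shift"
proof -
  define P where "P n w \<longleftrightarrow> loop_and_circuit (parcs (G n)) (v n) (length (c n)) w \<and>
      set (e n) = {(v n, v n)} \<and> set (c n) = (\<lambda>k. (w k, w (Suc k))) ` {..<length (c n)}" for n w
  have "\<exists>w. P n w" if "n \<ge> 1" for n
    using assms(6)[OF that] unfolding P_def by (elim conjE figure_8_loop_and_circuit) blast+
  then obtain w where w: "\<And>n. n \<ge> 1 \<Longrightarrow> P n (w n)" by metis
  interpret loop_circuit_covering G \<phi> v "\<lambda>n. length (c n)" w
  proof
    show "\<phi> (Suc n) (v (Suc n)) = v n" for n
      using assms(1) by (simp add: KR_covering_def)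
    show "loop_and_circuit (parcs (G n)) (v n) (length (c n)) (w n)" if "n \<ge> 1" for n
      using w[OF that] by (simp add: P_def)
  qed (rule assms(2))
  have "P 1 (w 1)" by (rule w) simp
  then show ?thesis
    unfolding P_def by (elim conjE) (rule topologically_conjugate_itinerary)
qed

end
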